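(* Let $G \in \mathcal{S}_{2,3}$ be a graph such that $G - V_2(G)$ is a collection of thick cacti (i.e. every connected component of $G - V_2(G)$ is a thick cactus). Then $G$ can be decomposed into a spanning tree and a matching.
   Context: All graphs are finite and have no loops, but may contain parallel edges. A cycle is a connected $2$-regular graph; cycles with two edges (formed by two parallel edges) are allowed. For $F \subseteq E(G)$, $G \setminus F$ denotes the graph $(V(G), E(G)\setminus F)$ (no vertices are deleted). A cycle $C$ in a connected graph $G$ is separating if $G \setminus E(C)$ is disconnected. $\mathcal{S}_{2,3}$ is the class of connected graphs with minimum degree at least $2$ and maximum degree at most $3$ in which every cycle is separating. $V_k(G)$ denotes the set of vertices of $G$ of degree $k$, and $G - S$ denotes the graph obtained from $G$ by deleting the vertices in $S$ and all edges incident to them. A graph is a cactus if it is connected and every edge is contained in at most one cycle; a cactus is thick if every one of its vertices belongs to a cycle. $G$ is decomposed into a spanning tree and a matching if $E(G)$ can be partitioned into the edge set of a spanning tree of $G$ and a (possibly empty) matching. *)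

theory Defs
  imports Main
begin

text \<open>
  Finite loopless undirected multigraphs. Edges are objects of their own, so that parallel edges
  are distinct edges with the same pair of ends.
\<close>

record ('v, 'e) mgraph =
  verts :: "'v set"
  edges :: "'e set"
  ends :: "'e \<Rightarrow> 'v set"

definition wf_mgraph :: "('v, 'e) mgraph \<Rightarrow> bool" where
  "wf_mgraph G \<longleftrightarrow> finite (verts G) \<and> finite (edges G) \<and>
     (\<forall>e \<in> edges G. ends G e \<subseteq> verts G \<and> card (ends G e) = 2)"

text \<open>
  A subgraph inherits the whole function \<open>ends\<close>, also its irrelevant values outside the edge set;
  hence two subgraphs of the same graph are equal as records iff they have the same vertices and
  the same edges.
\<close>

definition subgraph :: "('v, 'e) mgraph \<Rightarrow> ('v, 'e) mgraph \<Rightarrow> bool" where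
  "subgraph H G \<longleftrightarrow> wf_mgraph H \<and> verts H \<subseteq> verts G \<and> edges H \<subseteq> edges G \<and> ends H = ends G"

definition degree :: "('v, 'e) mgraph \<Rightarrow> 'v \<Rightarrow> nat" where
  "degree G v = card {e \<in> edges G. v \<in> ends G e}"

definition verts_of_degree :: "nat \<Rightarrow> ('v, 'e) mgraph \<Rightarrow> 'v set" where
  "verts_of_degree k G = {v \<in> verts G. degree G v = k}"

definition delete_edges :: "('v, 'e) mgraph \<Rightarrow> 'e set \<Rightarrow> ('v, 'e) mgraph" where
  "delete_edges G F = G\<lparr>edges := edges G - F\<rparr>"

definition delete_verts :: "('v, 'e) mgraph \<Rightarrow> 'v set \<Rightarrow> ('v, 'e) mgraph" where
  "delete_verts G S =
     G\<lparr>verts := verts G - S, edges := {e \<in> edges G. ends G e \<inter> S = {}}\<rparr>"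

definition adj :: "('v, 'e) mgraph \<Rightarrow> ('v \<times> 'v) set" where
  "adj G = {(u, v). \<exists>e \<in> edges G. ends G e = {u, v}}"

text \<open>The graph without vertices is not regarded as connected.\<close>

definition connected_mgraph :: "('v, 'e) mgraph \<Rightarrow> bool" where
  "connected_mgraph G \<longleftrightarrow> verts G \<noteq> {} \<and> (\<forall>u \<in> verts G. \<forall>v \<in> verts G. (u, v) \<in> (adj G)\<^sup>*)"

definition component :: "('v, 'e) mgraph \<Rightarrow> ('v, 'e) mgraph \<Rightarrow> bool" where
  "component K G \<longleftrightarrow> subgraph K G \<and> connected_mgraph K \<and>
     (\<forall>H. subgraph H G \<and> connected_mgraph H \<and> subgraph K H \<longrightarrow> H = K)"

definition cycle_in :: "('v, 'e) mgraph \<Rightarrow> ('v, 'e) mgraph \<Rightarrow> bool" where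
  "cycle_in C G \<longleftrightarrow> subgraph C G \<and> connected_mgraph C \<and> (\<forall>v \<in> verts C. degree C v = 2)"

definition separating :: "('v, 'e) mgraph \<Rightarrow> ('v, 'e) mgraph \<Rightarrow> bool" where
  "separating C G \<longleftrightarrow> \<not> connected_mgraph (delete_edges G (edges C))"

definition S23 :: "('v, 'e) mgraph set" where
  "S23 = {G. wf_mgraph G \<and> connected_mgraph G \<and>
     (\<forall>v \<in> verts G. 2 \<le> degree G v \<and> degree G v \<le> 3) \<and>
     (\<forall>C. cycle_in C G \<longrightarrow> separating C G)}"

definition cactus :: "('v, 'e) mgraph \<Rightarrow> bool" where
  "cactus G \<longleftrightarrow> wf_mgraph G \<and> connected_mgraph G \<and>
     (\<forall>e \<in> edges G. \<forall>C D. cycle_in C G \<and> cycle_in D G \<and> e \<in> edges C \<and> e \<in> edges D \<longrightarrow> C = D)"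

definition thick_cactus :: "('v, 'e) mgraph \<Rightarrow> bool" where
  "thick_cactus G \<longleftrightarrow> cactus G \<and> (\<forall>v \<in> verts G. \<exists>C. cycle_in C G \<and> v \<in> verts C)"

definition spanning_tree :: "('v, 'e) mgraph \<Rightarrow> ('v, 'e) mgraph \<Rightarrow> bool" where
  "spanning_tree T G \<longleftrightarrow> subgraph T G \<and> verts T = verts G \<and>
     connected_mgraph T \<and> (\<nexists>C. cycle_in C T)"

definition matching :: "'e set \<Rightarrow> ('v, 'e) mgraph \<Rightarrow> bool" where
  "matching M G \<longleftrightarrow> M \<subseteq> edges G \<and>
     (\<forall>e \<in> M. \<forall>f \<in> M. e \<noteq> f \<longrightarrow> ends G e \<inter> ends G f = {})"

definition decomposable_tree_matching :: "('v, 'e) mgraph \<Rightarrow> bool" where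
  "decomposable_tree_matching G \<longleftrightarrow> (\<exists>T M. spanning_tree T G \<and> matching M G \<and>
     edges T \<union> M = edges G \<and> edges T \<inter> M = {})"

end

theory Submission
  imports Defs
begin

text \<open>
  Let \<open>V2\<close> and \<open>V3\<close> be the sets of vertices of degree two and three. By thickness, every vertex of
  \<open>V3\<close> lies on a cycle within \<open>V3\<close>, and two such cycles through a vertex of degree three would share
  an edge; so these \<^emph>\<open>core cycles\<close> partition \<open>V3\<close>, and at each vertex of \<open>V3\<close> there is at most
  one edge on no core cycle, its \<^emph>\<open>link\<close>. An edge at a vertex of \<open>V2\<close> is called
  \<^emph>\<open>soft\<close>. A cycle without soft edges is a core cycle.

  The matching consists of one edge \<open>p C\<close> of each core cycle \<open>C\<close> and a set \<open>D\<close> of soft edges that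
  do not touch any \<open>p C\<close>, maximal such that the graph without \<open>D\<close> is connected. No two edges of \<open>D\<close>
  share a vertex of \<open>V2\<close>, since that vertex would be isolated, nor a vertex of \<open>V3\<close>, since there is
  only one link. Deleting an edge from each of the disjoint core cycles preserves connectedness.
  A cycle in the remaining graph is not a core cycle, and by maximality of \<open>D\<close> all its soft edges
  touch selected edges; so it passes each of its vertices of \<open>V2\<close> between two ends of selected edges,
  which are then called \<^emph>\<open>opposite\<close>. It remains to choose \<open>p\<close> such that no such cycle exists
  (\<open>decomposition_of_selection\<close>).

  For this choice, fix a maximal set \<open>D0\<close> of soft edges whose deletion leaves the graph connected.
  Every cycle with a soft edge meets \<open>D0\<close>, so it suffices that no two opposite ends of
  selected edges are separated by an edge of \<open>D0\<close>. This never concerns a \<^emph>\<open>good\<close> vertex,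
  one whose link is not cut by \<open>D0\<close> at once or just behind a vertex of \<open>V2\<close>. Suppose that each core
  cycle has a good vertex \<open>r\<close>. If some edge of \<open>C\<close> has two good ends, select such an edge;
  otherwise let \<open>p C\<close> join \<open>r\<close> to one of its neighbours on \<open>C\<close>. There are two of them, because both
  vertices of a cycle of length two are good: this cycle is separating, so its links are
  bridges (\<open>parallel_edges_good\<close>). Each vertex is opposite to at most one other, so two options
  for each cycle allow a choice without opposite pairs (\<open>conflict_free_selection\<close>). If some core cycle has no good vertex, it is the
  only one (\<open>no_good_vertex_single_core_cycle\<close>), it has length at least three, and any of its edges
  with non-opposite ends can be selected.
\<close>

section \<open>Cuts, cycles and components of multigraphs\<close>

text \<open>The edge \<open>e\<close> belongs to the cut between \<open>W\<close> and its complement.\<close>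

definition crosses :: "('v, 'e) mgraph \<Rightarrow> 'e \<Rightarrow> 'v set \<Rightarrow> bool" where
  "crosses G e W \<longleftrightarrow> ends G e \<inter> W \<noteq> {} \<and> \<not> ends G e \<subseteq> W"

lemma wf_mgraph_other_end:
  assumes "wf_mgraph G" "e \<in> edges G" "v \<in> ends G e"
  obtains w where "w \<noteq> v" "ends G e = {v, w}" "w \<in> verts G"
proof -
  have "card (ends G e) = 2" "ends G e \<subseteq> verts G"
    using assms unfolding wf_mgraph_def by auto
  moreover from this obtain a b where "ends G e = {a, b}" "a \<noteq> b" unfolding card_2_iff by blast
  moreover from this have "v = a \<or> v = b" using assms(3) by simp
  ultimately show ?thesis using that[of a] that[of b] by (auto simp: insert_commute)
qed

lemma connected_mgraph_iff_crosses:
  assumes "wf_mgraph G"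
  shows "connected_mgraph G \<longleftrightarrow> verts G \<noteq> {} \<and>
    (\<forall>W. W \<subseteq> verts G \<and> W \<noteq> {} \<and> W \<noteq> verts G \<longrightarrow> (\<exists>e \<in> edges G. crosses G e W))"
    (is "?L \<longleftrightarrow> ?R")
proof
  assume L: ?L
  have "\<exists>e \<in> edges G. crosses G e W"
    if W: "W \<subseteq> verts G" "W \<noteq> {}" "W \<noteq> verts G" for W
  proof (rule ccontr)
    assume no: "\<not> (\<exists>e \<in> edges G. crosses G e W)"
    obtain u v where uv: "u \<in> W" "v \<in> verts G" "v \<notin> W" using W by blast
    then have "(u, v) \<in> (adj G)\<^sup>*" using L W unfolding connected_mgraph_def by blast
    then have "v \<in> W"
    proof (induction rule: rtrancl_induct)
      case base
      show ?case using uv by simp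
    next
      case (step y z)
      then obtain e where "e \<in> edges G" "ends G e = {y, z}" unfolding adj_def by auto
      then show ?case using no step.IH unfolding crosses_def by auto
    qed
    then show False using uv by simp
  qed
  then show ?R using L unfolding connected_mgraph_def by blast
next
  assume R: ?R
  have "(u, v) \<in> (adj G)\<^sup>*" if uv: "u \<in> verts G" "v \<in> verts G" for u v
  proof -
    let ?W = "{w \<in> verts G. (u, w) \<in> (adj G)\<^sup>*}"
    have "\<not> crosses G e ?W" if e: "e \<in> edges G" for e
    proof
      assume "crosses G e ?W"
      then obtain x where x: "x \<in> ends G e" "x \<in> ?W" and "\<not> ends G e \<subseteq> ?W"
        unfolding crosses_def by auto
      moreover obtain y where y: "ends G e = {x, y}" "y \<in> verts G"
        using wf_mgraph_other_end[OF assms e x(1)] by metis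
      moreover have "(x, y) \<in> adj G" using e y unfolding adj_def by auto
      ultimately show False by (auto intro: rtrancl.rtrancl_into_rtrancl)
    qed
    moreover have "?W \<noteq> {}" using uv by auto
    ultimately have "?W = verts G" using R by (metis (no_types, lifting) mem_Collect_eq subsetI)
    then show ?thesis using uv by auto
  qed
  then show ?L using R unfolding connected_mgraph_def by blast
qed

lemma connected_mgraph_crosses:
  assumes "wf_mgraph G" "connected_mgraph G" "W \<subseteq> verts G" "W \<noteq> {}" "W \<noteq> verts G"
  obtains e where "e \<in> edges G" "crosses G e W"
proof -
  have "\<forall>W. W \<subseteq> verts G \<and> W \<noteq> {} \<and> W \<noteq> verts G \<longrightarrow> (\<exists>e \<in> edges G. crosses G e W)"
    using connected_mgraph_iff_crosses[OF assms(1)] assms(2) by simp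
  then show ?thesis using that assms(3-5) by meson
qed

lemma not_connected_mgraph_cut:
  assumes "wf_mgraph G" "\<not> connected_mgraph G" "verts G \<noteq> {}"
  obtains W where "W \<subseteq> verts G" "W \<noteq> {}" "W \<noteq> verts G" "\<forall>e \<in> edges G. \<not> crosses G e W"
  using connected_mgraph_iff_crosses[OF assms(1)] assms(2,3) that by meson

lemma delete_edges_simps [simp]:
  "verts (delete_edges G F) = verts G"
  "edges (delete_edges G F) = edges G - F"
  "ends (delete_edges G F) = ends G"
  unfolding delete_edges_def by auto

lemma crosses_delete_edges [simp]: "crosses (delete_edges G F) e W \<longleftrightarrow> crosses G e W"
  unfolding crosses_def by simp

lemma delete_edges_empty [simp]: "delete_edges G {} = G"
  unfolding delete_edges_def by simp

lemma delete_edges_delete_edges: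
  "delete_edges (delete_edges G F) F' = delete_edges G (F \<union> F')"
  unfolding delete_edges_def by (simp add: Diff_eq Int_assoc)

lemma delete_verts_simps [simp]:
  "verts (delete_verts G S) = verts G - S"
  "edges (delete_verts G S) = {e \<in> edges G. ends G e \<inter> S = {}}"
  "ends (delete_verts G S) = ends G"
  unfolding delete_verts_def by auto

lemma wf_delete_edges: "wf_mgraph G \<Longrightarrow> wf_mgraph (delete_edges G F)"
  unfolding wf_mgraph_def by auto

lemma wf_delete_verts: "wf_mgraph G \<Longrightarrow> wf_mgraph (delete_verts G S)"
  unfolding wf_mgraph_def by auto

lemma cycle_in_delete_edges_iff:
  "cycle_in C (delete_edges G F) \<longleftrightarrow> cycle_in C G \<and> edges C \<inter> F = {}"
  unfolding cycle_in_def subgraph_def by auto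

lemma cycle_in_simps:
  assumes "cycle_in C G"
  shows "wf_mgraph C" "verts C \<subseteq> verts G" "edges C \<subseteq> edges G" "ends C = ends G"
    "finite (edges C)" "finite (verts C)" "verts C \<noteq> {}"
proof -
  show wf: "wf_mgraph C" and "verts C \<subseteq> verts G" "edges C \<subseteq> edges G" "ends C = ends G"
    "verts C \<noteq> {}"
    using assms unfolding cycle_in_def subgraph_def connected_mgraph_def by blast+
  show "finite (edges C)" "finite (verts C)" using wf unfolding wf_mgraph_def by blast+
qed

lemma cycle_in_incident_card:
  assumes "cycle_in C G" "v \<in> verts C"
  shows "card {e \<in> edges C. v \<in> ends G e} = 2"
  using assms cycle_in_simps(4)[OF assms(1)] unfolding cycle_in_def degree_def by auto

lemma cycle_in_two_edges:
  assumes "cycle_in C G" "v \<in> verts C"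
  obtains e f where "e \<in> edges C" "f \<in> edges C" "e \<noteq> f" "v \<in> ends G e" "v \<in> ends G f"
proof -
  obtain e f where "{e \<in> edges C. v \<in> ends G e} = {e, f}" "e \<noteq> f"
    using cycle_in_incident_card[OF assms] unfolding card_2_iff by blast
  then show ?thesis using that by blast
qed

lemma cycle_in_ends:
  assumes "cycle_in C G" "e \<in> edges C"
  shows "ends G e \<subseteq> verts C" "card (ends G e) = 2"
  using assms cycle_in_simps[OF assms(1)] unfolding wf_mgraph_def by metis+

text \<open>
  A cycle meets every cut in an even number of edges: counted with multiplicity, the edge ends
  in \<open>W\<close> number twice the vertices of the cycle in \<open>W\<close>.
\<close>

lemma cycle_crosses_twice:
  assumes C: "cycle_in C G" and e: "e \<in> edges C" "crosses G e W"
  obtains f where "f \<in> edges C" "f \<noteq> e" "crosses G f W"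
proof -
  let ?W = "W \<inter> verts C"
  have "\<exists>f \<in> edges C. f \<noteq> e \<and> crosses G f W"
  proof (rule ccontr)
    assume no: "\<not> ?thesis"
    have fin: "finite ?W" "finite (edges C)" using cycle_in_simps[OF C] by auto
    have "(\<Sum>v\<in>?W. card {f \<in> edges C. v \<in> ends G f}) = (\<Sum>v\<in>?W. 2)"
      using cycle_in_incident_card[OF C] by (intro sum.cong) auto
    moreover have "(\<Sum>v\<in>?W. card {f \<in> edges C. v \<in> ends G f})
        = (\<Sum>f\<in>edges C. card {v \<in> ?W. v \<in> ends G f})"
      using sum.swap_restrict[of ?W "edges C" "\<lambda>_ _. 1::nat" "\<lambda>v f. v \<in> ends G f"] fin by simp
    moreover have "even (\<Sum>f\<in>edges C - {e}. card {v \<in> ?W. v \<in> ends G f})"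
    proof (rule dvd_sum)
      fix f assume f: "f \<in> edges C - {e}"
      then have nc: "\<not> crosses G f W" using no by auto
      note ends = cycle_in_ends[OF C, of f]
      have "{v \<in> ?W. v \<in> ends G f} = {} \<or> {v \<in> ?W. v \<in> ends G f} = ends G f"
        using nc f ends unfolding crosses_def by auto
      then have "card {v \<in> ?W. v \<in> ends G f} = 0 \<or> card {v \<in> ?W. v \<in> ends G f} = 2"
        using f ends(2) by (metis DiffD1 card.empty)
      then show "even (card {v \<in> ?W. v \<in> ends G f})" by auto
    qed
    moreover have "card {v \<in> ?W. v \<in> ends G e} = 1"
    proof -
      obtain x y where xy: "ends G e = {x, y}" "x \<noteq> y"
        using cycle_in_ends(2)[OF C e(1)] unfolding card_2_iff by blast
      have "{v \<in> ?W. v \<in> ends G e} = {x} \<or> {v \<in> ?W. v \<in> ends G e} = {y}"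
        using e(2) xy cycle_in_ends(1)[OF C e(1)] unfolding crosses_def by auto
      then show ?thesis by auto
    qed
    ultimately show False
      using sum.remove[OF fin(2) e(1), of "\<lambda>f. card {v \<in> ?W. v \<in> ends G f}"] by simp presburger
  qed
  then show ?thesis using that by blast
qed

lemma connected_delete_edges_of_cycles:
  assumes wf: "wf_mgraph G" and conn: "connected_mgraph G"
    and X: "\<And>e. e \<in> X \<Longrightarrow> \<exists>C. cycle_in C G \<and> edges C \<inter> X = {e}"
  shows "connected_mgraph (delete_edges G X)"
proof -
  have "\<exists>e \<in> edges G - X. crosses G e W"
    if W: "W \<subseteq> verts G" "W \<noteq> {}" "W \<noteq> verts G" for W
  proof -
    obtain e where e: "e \<in> edges G" "crosses G e W"
      using connected_mgraph_crosses[OF wf conn W] .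
    show ?thesis
    proof (cases "e \<in> X")
      case True
      then obtain C where C: "cycle_in C G" "edges C \<inter> X = {e}" using X by blast
      then obtain f where "f \<in> edges C" "f \<noteq> e" "crosses G f W"
        using cycle_crosses_twice[OF C(1) _ e(2)] by blast
      then show ?thesis using C cycle_in_simps(3)[OF C(1)] by blast
    qed (use e in blast)
  qed
  moreover have "verts G \<noteq> {}" using conn unfolding connected_mgraph_def by blast
  ultimately show ?thesis
    unfolding connected_mgraph_iff_crosses[OF wf_delete_edges[OF wf]] by (simp add: crosses_def)
qed

lemma component_of_vertex:
  assumes wf: "wf_mgraph H" and v: "v \<in> verts H"
  obtains K where "component K H" "v \<in> verts K"
    "\<And>S. subgraph S H \<Longrightarrow> connected_mgraph S \<Longrightarrow> v \<in> verts S \<Longrightarrow> subgraph S K"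
proof -
  let ?R = "{w \<in> verts H. (v, w) \<in> (adj H)\<^sup>*}"
  let ?K = "H\<lparr>verts := ?R, edges := {e \<in> edges H. ends H e \<subseteq> ?R}\<rparr>"
  have K: "subgraph ?K H" using wf unfolding subgraph_def wf_mgraph_def by auto
  have sym: "sym (adj ?K)" unfolding sym_def adj_def by (auto simp: insert_commute)
  have reach: "(v, w) \<in> (adj ?K)\<^sup>* \<and> w \<in> ?R" if "(v, w) \<in> (adj H)\<^sup>*" for w
    using that
  proof (induction rule: rtrancl_induct)
    case base
    then show ?case using v by simp
  next
    case (step y z)
    then obtain e where e: "e \<in> edges H" "ends H e = {y, z}" unfolding adj_def by auto
    then have "z \<in> verts H" using wf unfolding wf_mgraph_def by auto
    then have z: "z \<in> ?R" using step.hyps by (auto intro: rtrancl.rtrancl_into_rtrancl)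
    then have "(y, z) \<in> adj ?K" using e step.IH unfolding adj_def by auto
    then show ?case using step.IH z by (meson rtrancl.rtrancl_into_rtrancl)
  qed
  have conn: "connected_mgraph ?K"
    unfolding connected_mgraph_def
  proof (intro conjI ballI)
    show "verts ?K \<noteq> {}" using v by auto
  next
    fix a b assume "a \<in> verts ?K" "b \<in> verts ?K"
    then have "(v, a) \<in> (adj ?K)\<^sup>*" "(v, b) \<in> (adj ?K)\<^sup>*" using reach by auto
    moreover have "sym ((adj ?K)\<^sup>*)" using sym by (rule sym_rtrancl)
    ultimately show "(a, b) \<in> (adj ?K)\<^sup>*" by (meson rtrancl_trans symD)
  qed
  have sub: "subgraph S ?K" if S: "subgraph S H" "connected_mgraph S" "v \<in> verts S" for S
  proof -
    have "adj S \<subseteq> adj H" using S(1) unfolding adj_def subgraph_def by auto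
    then have "(adj S)\<^sup>* \<subseteq> (adj H)\<^sup>*" by (rule rtrancl_mono)
    then have "verts S \<subseteq> ?R"
      using S unfolding connected_mgraph_def subgraph_def by blast
    then show ?thesis using S(1) unfolding subgraph_def wf_mgraph_def by force
  qed
  have "component ?K H"
    unfolding component_def
  proof (intro conjI allI impI K conn)
    fix S assume S: "subgraph S H \<and> connected_mgraph S \<and> subgraph ?K S"
    then have "v \<in> verts S" using v unfolding subgraph_def by auto
    then have "subgraph S ?K" using S sub by blast
    then have "verts S = verts ?K" "edges S = edges ?K" "ends S = ends ?K"
      using S unfolding subgraph_def by blast+
    then show "S = ?K" by (rule mgraph.equality) simp
  qed
  moreover have "v \<in> verts ?K" using v by simp
  ultimately show ?thesis using sub by (rule that)
qed

section \<open>Selecting representatives without conflicts\<close>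

text \<open>
  Since every item conflicts with at most one other item, two items per index suffice for a
  conflict-free choice. The induction needs one item \<open>p\<close> to be avoided: after an item has been
  chosen for one index, its only conflicting item has to be avoided by the remaining indices.
\<close>

lemma conflict_free_selection:
  assumes "finite X"
    and two: "\<And>x. x \<in> X \<Longrightarrow> \<exists>a \<in> S x. \<exists>b \<in> S x. a \<noteq> b"
    and disj: "\<And>x y a. x \<in> X \<Longrightarrow> y \<in> X \<Longrightarrow> a \<in> S x \<Longrightarrow> a \<in> S y \<Longrightarrow> x = y"
    and sym: "\<And>a b. R a b \<Longrightarrow> R b a" and irr: "\<And>a. \<not> R a a"
    and func: "\<And>a b c. R a b \<Longrightarrow> R a c \<Longrightarrow> b = c"
  shows "\<exists>s. \<forall>x \<in> X. s x \<in> S x \<and> s x \<noteq> p \<and> (\<forall>y \<in> X. \<not> R (s x) (s y))"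
  using assms(1) two disj
proof (induction "card X" arbitrary: X p)
  case 0
  then show ?case by simp
next
  case (Suc n)
  obtain x0 where x0: "x0 \<in> X" "\<And>x. x \<in> X \<Longrightarrow> p \<in> S x \<Longrightarrow> x = x0"
  proof (cases "\<exists>x \<in> X. p \<in> S x")
    case True
    then show ?thesis using that Suc.prems(3) by blast
  next
    case False
    moreover have "X \<noteq> {}" using Suc.hyps(2) by auto
    ultimately show ?thesis using that by blast
  qed
  obtain a where a: "a \<in> S x0" "a \<noteq> p" using Suc.prems(2)[OF x0(1)] by metis
  \<comment> \<open>The only item, if any, that conflicts with \<open>a\<close>; an arbitrary one otherwise.\<close>
  define q where "q = (THE b. R a b)"
  have q: "b = q" if "R a b" for b
    unfolding q_def using that func by (metis the_equality)
  have "n = card (X - {x0})" using Suc.hyps(2) x0(1) Suc.prems(1) by simp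
  then have "\<exists>s. \<forall>x \<in> X - {x0}. s x \<in> S x \<and> s x \<noteq> q \<and> (\<forall>y \<in> X - {x0}. \<not> R (s x) (s y))"
    using Suc.prems by (intro Suc.hyps(1)) auto
  then obtain s where s: "\<And>x. x \<in> X - {x0} \<Longrightarrow>
      s x \<in> S x \<and> s x \<noteq> q \<and> (\<forall>y \<in> X - {x0}. \<not> R (s x) (s y))" by blast
  have "(s(x0 := a)) x \<in> S x \<and> (s(x0 := a)) x \<noteq> p \<and>
      (\<forall>y \<in> X. \<not> R ((s(x0 := a)) x) ((s(x0 := a)) y))" if x: "x \<in> X" for x
  proof (cases "x = x0")
    case True
    then show ?thesis using a irr s q by auto
  next
    case False
    then have "s x \<in> S x" "s x \<noteq> q" "\<forall>y \<in> X - {x0}. \<not> R (s x) (s y)" using s x by blast+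
    moreover have "s x \<noteq> p" using x0(2)[OF x] False calculation(1) by auto
    moreover have "\<not> R (s x) a" using sym q calculation(2) by blast
    ultimately show ?thesis using False by auto
  qed
  then show ?case by blast
qed

section \<open>Graphs whose cubic part consists of thick cacti\<close>

locale thick_cacti_graph =
  fixes G :: "('v, 'e) mgraph"
  assumes G_S23: "G \<in> S23"
    and cacti: "\<And>K. component K (delete_verts G (verts_of_degree 2 G)) \<Longrightarrow> thick_cactus K"
begin

abbreviation V2 :: "'v set" where "V2 \<equiv> verts_of_degree 2 G"
abbreviation V3 :: "'v set" where "V3 \<equiv> verts_of_degree 3 G"

text \<open>
  The cycles of the cacti, described without reference to the components of the cubic part.
\<close>

definition core_cycles :: "('v, 'e) mgraph set" where
  "core_cycles = {C. cycle_in C G \<and> verts C \<subseteq> V3}"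

text \<open>
  The edges that lie on no cycle of a cactus: the bridges of the cacti and the edges at vertices of
  degree two.
\<close>

definition links :: "'e set" where
  "links = {e \<in> edges G. \<forall>C \<in> core_cycles. e \<notin> edges C}"

text \<open>The edges at vertices of degree two.\<close>

definition soft :: "'e set" where
  "soft = {e \<in> edges G. ends G e \<inter> V2 \<noteq> {}}"

lemma wf: "wf_mgraph G" and conn: "connected_mgraph G"
  and sep: "cycle_in C G \<Longrightarrow> separating C G"
  using G_S23 unfolding S23_def by auto

lemma fin_edges: "finite (edges G)" and fin_verts: "finite (verts G)"
  using wf unfolding wf_mgraph_def by auto

lemma verts_cases: "v \<in> verts G \<Longrightarrow> v \<in> V2 \<or> v \<in> V3"
  using G_S23 unfolding S23_def verts_of_degree_def by force

lemma V2_V3_disjoint: "v \<in> V2 \<Longrightarrow> v \<notin> V3"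
  unfolding verts_of_degree_def by auto

lemma ends_verts: "e \<in> edges G \<Longrightarrow> v \<in> ends G e \<Longrightarrow> v \<in> verts G"
  using wf unfolding wf_mgraph_def by blast

lemmas other_end = wf_mgraph_other_end[OF wf]

lemma V2_incident:
  assumes "x \<in> V2" "e \<in> edges G" "f \<in> edges G" "g \<in> edges G"
    "x \<in> ends G e" "x \<in> ends G f" "x \<in> ends G g" "e \<noteq> f"
  shows "g = e \<or> g = f"
proof -
  have "card {e \<in> edges G. x \<in> ends G e} = 2"
    using assms(1) unfolding verts_of_degree_def degree_def by auto
  then obtain a b where "{e \<in> edges G. x \<in> ends G e} = {a, b}" unfolding card_2_iff by blast
  then have "e \<in> {a, b}" "f \<in> {a, b}" "g \<in> {a, b}" using assms by blast+
  then show ?thesis using assms(8) by auto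
qed

lemma V3_incident:
  assumes "v \<in> V3" "A \<subseteq> {e \<in> edges G. v \<in> ends G e}"
  shows "card A \<le> 3"
proof -
  have "card {e \<in> edges G. v \<in> ends G e} = 3"
    using assms(1) unfolding verts_of_degree_def degree_def by auto
  moreover have "finite {e \<in> edges G. v \<in> ends G e}" using fin_edges by auto
  ultimately show ?thesis using card_mono assms(2) by metis
qed

lemma core_cycle_cycle_in: "C \<in> core_cycles \<Longrightarrow> cycle_in C G"
  and core_cycle_verts: "C \<in> core_cycles \<Longrightarrow> v \<in> verts C \<Longrightarrow> v \<in> V3"
  unfolding core_cycles_def by auto

lemma core_cycle_edges: "C \<in> core_cycles \<Longrightarrow> e \<in> edges C \<Longrightarrow> e \<in> edges G"
  using cycle_in_simps(3)[OF core_cycle_cycle_in] by blast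

lemma core_cycle_ends: "C \<in> core_cycles \<Longrightarrow> e \<in> edges C \<Longrightarrow> v \<in> ends G e \<Longrightarrow> v \<in> verts C"
  using cycle_in_ends(1)[OF core_cycle_cycle_in] by blast

lemma core_cycle_nonempty: "C \<in> core_cycles \<Longrightarrow> \<exists>v. v \<in> verts C"
  using cycle_in_simps(7)[OF core_cycle_cycle_in] by blast

lemma core_cycle_incident:
  assumes "C \<in> core_cycles" "v \<in> verts C"
  shows "card {e \<in> edges C. v \<in> ends G e} = 2" "finite {e \<in> edges C. v \<in> ends G e}"
proof -
  note cyc = core_cycle_cycle_in[OF assms(1)]
  show "card {e \<in> edges C. v \<in> ends G e} = 2" by (rule cycle_in_incident_card[OF cyc assms(2)])
  show "finite {e \<in> edges C. v \<in> ends G e}" using cycle_in_simps(5)[OF cyc] by simp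
qed

lemma core_cycle_exists:
  assumes v: "v \<in> V3"
  obtains C where "C \<in> core_cycles" "v \<in> verts C"
proof -
  let ?H = "delete_verts G V2"
  have "v \<in> verts ?H" using v V2_V3_disjoint unfolding verts_of_degree_def by auto
  then obtain K where K: "component K ?H" "v \<in> verts K"
    using component_of_vertex[OF wf_delete_verts[OF wf]] by metis
  then obtain C where C: "cycle_in C K" "v \<in> verts C"
    using cacti unfolding thick_cactus_def by blast
  have "subgraph K ?H" using K(1) unfolding component_def by blast
  then have "cycle_in C G" "verts C \<subseteq> verts G - V2"
    using C(1) unfolding cycle_in_def subgraph_def by auto
  then show ?thesis using that C(2) verts_cases unfolding core_cycles_def by blast
qed

text \<open>
  Two cycles through a vertex of degree three share an edge there, which a cactus forbids.
\<close>

lemma core_cycle_unique: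
  assumes C: "C \<in> core_cycles" "v \<in> verts C" and D: "D \<in> core_cycles" "v \<in> verts D"
  shows "C = D"
proof -
  let ?H = "delete_verts G V2"
  have v: "v \<in> V3" using core_cycle_verts C by blast
  have "v \<in> verts ?H" using v V2_V3_disjoint unfolding verts_of_degree_def by auto
  then obtain K where K: "component K ?H"
    and sub: "\<And>S. subgraph S ?H \<Longrightarrow> connected_mgraph S \<Longrightarrow> v \<in> verts S \<Longrightarrow> subgraph S K"
    using component_of_vertex[OF wf_delete_verts[OF wf]] by metis
  have in_K: "cycle_in B K" if B: "B \<in> core_cycles" "v \<in> verts B" for B
  proof -
    have cyc: "cycle_in B G" and V: "verts B \<subseteq> V3" using B(1) unfolding core_cycles_def by auto
    have "ends G e \<inter> V2 = {}" if "e \<in> edges B" for e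
      using cycle_in_ends(1)[OF cyc that] V V2_V3_disjoint by blast
    moreover have "verts B \<inter> V2 = {}" using V V2_V3_disjoint by blast
    ultimately have "subgraph B ?H" using cyc unfolding cycle_in_def subgraph_def by auto
    then show ?thesis using sub B(2) cyc unfolding cycle_in_def by blast
  qed
  let ?I = "\<lambda>F. {e \<in> F. v \<in> ends G e}"
  have "?I (edges C) \<inter> ?I (edges D) \<noteq> {}"
  proof
    assume "?I (edges C) \<inter> ?I (edges D) = {}"
    then have "card (?I (edges C) \<union> ?I (edges D)) = 2 + 2"
      using card_Un_disjoint[OF core_cycle_incident(2)[OF C] core_cycle_incident(2)[OF D]]
      by (simp only: core_cycle_incident(1)[OF C] core_cycle_incident(1)[OF D])
    moreover have "?I (edges C) \<union> ?I (edges D) \<subseteq> ?I (edges G)"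
      using core_cycle_edges C(1) D(1) by blast
    ultimately show False using V3_incident[OF v, of "?I (edges C) \<union> ?I (edges D)"] by linarith
  qed
  then obtain e where "e \<in> edges C" "e \<in> edges D" by blast
  moreover have "cactus K" using cacti[OF K] unfolding thick_cactus_def by blast
  moreover have "e \<in> edges K" using cycle_in_simps(3)[OF in_K[OF C]] calculation by blast
  ultimately show ?thesis using in_K[OF C] in_K[OF D] unfolding cactus_def by blast
qed

lemma finite_core_cycles: "finite core_cycles"
proof (rule inj_on_finite[of verts _ "Pow (verts G)"])
  show "inj_on verts core_cycles"
  proof (rule inj_onI)
    fix C D assume CD: "C \<in> core_cycles" "D \<in> core_cycles" "verts C = verts D"
    then obtain v where "v \<in> verts C" using core_cycle_nonempty by blast
    then show "C = D" using core_cycle_unique CD by auto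
  qed
  show "verts ` core_cycles \<subseteq> Pow (verts G)"
    using cycle_in_simps(2)[OF core_cycle_cycle_in] by blast
qed (use fin_verts in simp)

lemma core_cycle_edge_or_link:
  assumes C: "C \<in> core_cycles" "v \<in> verts C" and e: "e \<in> edges G" "v \<in> ends G e"
  shows "e \<in> edges C \<or> e \<in> links"
proof (cases "e \<in> links")
  case False
  then obtain D where D: "D \<in> core_cycles" "e \<in> edges D" using e unfolding links_def by blast
  then have "D = C" using core_cycle_unique[OF D(1) _ C] core_cycle_ends e(2) by blast
  then show ?thesis using D by blast
qed simp

lemma link_unique:
  assumes v: "v \<in> V3" and e: "e \<in> links" "v \<in> ends G e" and f: "f \<in> links" "v \<in> ends G f"
  shows "e = f"
proof (rule ccontr)
  assume "e \<noteq> f"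
  obtain C where C: "C \<in> core_cycles" "v \<in> verts C" using core_cycle_exists[OF v] .
  let ?I = "\<lambda>F. {e \<in> F. v \<in> ends G e}"
  have "e \<notin> edges C" "f \<notin> edges C" using e f C unfolding links_def by auto
  then have "card (insert e (insert f (?I (edges C)))) = 4"
    using \<open>e \<noteq> f\<close> core_cycle_incident[OF C] by simp
  moreover have "insert e (insert f (?I (edges C))) \<subseteq> ?I (edges G)"
    using e f core_cycle_edges[OF C(1)] unfolding links_def by auto
  ultimately show False using V3_incident[OF v, of "insert e (insert f (?I (edges C)))"] by linarith
qed

lemma soft_links: "soft \<subseteq> links"
proof
  fix e assume e: "e \<in> soft"
  then obtain x where x: "x \<in> V2" "x \<in> ends G e" "e \<in> edges G" unfolding soft_def by blast
  have "e \<notin> edges C" if C: "C \<in> core_cycles" for C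
    using core_cycle_ends[OF C] core_cycle_verts[OF C] x V2_V3_disjoint by blast
  then show "e \<in> links" using x unfolding links_def by blast
qed

lemma V2_edge_soft: "x \<in> V2 \<Longrightarrow> e \<in> edges G \<Longrightarrow> x \<in> ends G e \<Longrightarrow> e \<in> soft"
  unfolding soft_def by blast

lemma cycle_without_soft_is_core:
  assumes Z: "cycle_in Z G" "edges Z \<inter> soft = {}"
  shows "Z \<in> core_cycles"
proof -
  have "v \<in> V3" if v: "v \<in> verts Z" for v
  proof -
    obtain e where "e \<in> edges Z" "v \<in> ends G e" using cycle_in_two_edges[OF Z(1) v] by metis
    then show ?thesis
      using V2_edge_soft Z(2) cycle_in_simps(2,3)[OF Z(1)] verts_cases v by blast
  qed
  then show ?thesis using Z(1) unfolding core_cycles_def by blast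
qed

text \<open>
  An inclusion-maximal set of soft edges outside \<open>A\<close> whose deletion leaves the graph connected.
\<close>

lemma maximal_soft_deletion:
  obtains D where "D \<subseteq> soft - A" "connected_mgraph (delete_edges G D)"
    "\<And>Z. cycle_in Z G \<Longrightarrow> edges Z \<inter> D = {} \<Longrightarrow> edges Z \<inter> soft \<subseteq> A"
proof -
  let ?P = "{D. D \<subseteq> soft - A \<and> connected_mgraph (delete_edges G D)}"
  have "finite soft" using fin_edges unfolding soft_def by auto
  then have "finite ?P" by auto
  moreover have "{} \<in> ?P" using conn by simp
  ultimately obtain D where D: "D \<in> ?P" "\<And>B. B \<in> ?P \<Longrightarrow> D \<subseteq> B \<Longrightarrow> B = D"
    using finite_has_maximal[of ?P] by (metis (no_types, lifting) empty_iff)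
  have "edges Z \<inter> soft \<subseteq> A" if Z: "cycle_in Z G" "edges Z \<inter> D = {}" for Z
  proof
    fix e assume e: "e \<in> edges Z \<inter> soft"
    show "e \<in> A"
    proof (rule ccontr)
      assume "e \<notin> A"
      have "cycle_in Z (delete_edges G D)" "edges Z \<inter> {e} = {e}"
        using Z e by (auto simp: cycle_in_delete_edges_iff)
      then have "connected_mgraph (delete_edges (delete_edges G D) {e})"
        using connected_delete_edges_of_cycles[OF wf_delete_edges[OF wf, of D], of "{e}"] D(1)
        by blast
      then have "D \<union> {e} \<in> ?P" using D(1) e \<open>e \<notin> A\<close> by (auto simp: delete_edges_delete_edges)
      then show False using D(2) Z(2) e by blast
    qed
  qed
  then show ?thesis using that[of D] D(1) by blast
qed

section \<open>From an edge selection to a decomposition\<close>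

text \<open>The soft edges that share an end with a selected edge of some core cycle.\<close>

definition blocked :: "(('v, 'e) mgraph \<Rightarrow> 'e) \<Rightarrow> 'e set" where
  "blocked p = {e \<in> soft. \<exists>C \<in> core_cycles. ends G e \<inter> ends G (p C) \<noteq> {}}"

text \<open>
  It suffices to select edges such that every cycle with a soft edge has an unblocked one: a maximal
  set of unblocked soft edges then destroys all cycles other than the core cycles.
\<close>

lemma decomposition_of_selection:
  assumes p: "\<And>C. C \<in> core_cycles \<Longrightarrow> p C \<in> edges C"
    and free: "\<And>Z. cycle_in Z G \<Longrightarrow> edges Z \<inter> soft \<subseteq> blocked p \<Longrightarrow> edges Z \<inter> soft = {}"
  shows "decomposable_tree_matching G"
proof -
  obtain D where D: "D \<subseteq> soft - blocked p" "connected_mgraph (delete_edges G D)"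
    and max: "\<And>Z. cycle_in Z G \<Longrightarrow> edges Z \<inter> D = {} \<Longrightarrow> edges Z \<inter> soft \<subseteq> blocked p"
    using maximal_soft_deletion[of "blocked p"] by metis
  define X where "X = p ` core_cycles"
  let ?M = "D \<union> X"
  let ?T = "delete_edges G ?M"
  have D_links: "D \<subseteq> links" using D(1) soft_links by blast
  have D_edges: "D \<subseteq> edges G" using D_links unfolding links_def by blast
  have X_edges: "X \<subseteq> edges G"
    using p core_cycle_edges unfolding X_def by blast
  have p_verts: "ends G (p C) \<subseteq> verts C" if "C \<in> core_cycles" for C
    using core_cycle_ends p that by blast
  have "connected_mgraph ?T"
  proof -
    have "\<exists>C. cycle_in C (delete_edges G D) \<and> edges C \<inter> X = {e}" if e: "e \<in> X" for e
    proof -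
      obtain C where C: "C \<in> core_cycles" "e = p C" using e unfolding X_def by blast
      have "edges C \<inter> D = {}" using C D_links unfolding links_def by blast
      moreover have "f = e" if f: "f \<in> edges C" "f \<in> X" for f
      proof -
        obtain B where B: "B \<in> core_cycles" "f = p B" using f unfolding X_def by blast
        have "card (ends G f) = 2" by (rule cycle_in_ends(2)[OF core_cycle_cycle_in[OF C(1)] f(1)])
        then obtain v where v: "v \<in> ends G f" by fastforce
        have "v \<in> verts C" "v \<in> verts B" using core_cycle_ends[OF C(1) f(1) v] p_verts B v by blast+
        then have "B = C" using core_cycle_unique B(1) C(1) by blast
        then show ?thesis using B C by simp
      qed
      ultimately show ?thesis
        using C e p core_cycle_cycle_in
        by (intro exI[of _ C]) (auto simp: cycle_in_delete_edges_iff)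
    qed
    then show ?thesis
      using connected_delete_edges_of_cycles[OF wf_delete_edges[OF wf] D(2)]
      by (simp add: delete_edges_delete_edges)
  qed
  moreover have "\<not> cycle_in Z ?T" for Z
  proof
    assume "cycle_in Z ?T"
    then have Z: "cycle_in Z G" "edges Z \<inter> D = {}" "edges Z \<inter> X = {}"
      by (auto simp: cycle_in_delete_edges_iff)
    then have "Z \<in> core_cycles" using cycle_without_soft_is_core free max by blast
    then show False using Z(3) p unfolding X_def by blast
  qed
  moreover have "subgraph ?T G" using wf_delete_edges[OF wf] unfolding subgraph_def by auto
  ultimately have tree: "spanning_tree ?T G" unfolding spanning_tree_def by auto
  have DX: "ends G d \<inter> ends G e = {}" if "d \<in> D" "e \<in> X" for d e
    using that D(1) unfolding X_def blocked_def by blast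
  have DD: "ends G d \<inter> ends G e = {}" if de: "d \<in> D" "e \<in> D" "d \<noteq> e" for d e
  proof (rule ccontr)
    assume "ends G d \<inter> ends G e \<noteq> {}"
    then obtain v where v: "v \<in> ends G d" "v \<in> ends G e" by blast
    have "v \<notin> V3" using link_unique v de D_links by blast
    then have v2: "v \<in> V2" using verts_cases ends_verts v de D_edges by blast
    obtain w where w: "w \<noteq> v" "w \<in> verts G" "v \<in> verts G"
      using other_end[OF _ v(1)] de(1) D_edges ends_verts v(1) by (metis subsetD)
    \<comment> \<open>Deleting both edges at a vertex of degree two would isolate it.\<close>
    have "\<not> crosses G f {v}" if "f \<in> edges G - D" for f
      using V2_incident[OF v2, of d e f] that de v D_edges unfolding crosses_def by auto
    moreover have "{v} \<subseteq> verts G" "{v} \<noteq> {}" "{v} \<noteq> verts G" using w by auto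
    ultimately show False
      using connected_mgraph_crosses[OF wf_delete_edges[OF wf] D(2), of "{v}"]
      by (metis crosses_delete_edges delete_edges_simps(1,2))
  qed
  have XX: "ends G d \<inter> ends G e = {}" if de: "d \<in> X" "e \<in> X" "d \<noteq> e" for d e
  proof (rule ccontr)
    assume "ends G d \<inter> ends G e \<noteq> {}"
    then obtain v where v: "v \<in> ends G d" "v \<in> ends G e" by blast
    obtain B C where "B \<in> core_cycles" "d = p B" "C \<in> core_cycles" "e = p C"
      using de(1,2) unfolding X_def by blast
    then show False using core_cycle_unique[of B v C] p_verts v de(3) by blast
  qed
  have "matching ?M G"
    unfolding matching_def
  proof (intro conjI ballI impI)
    show "?M \<subseteq> edges G" using D_edges X_edges by blast
  next
    fix d e assume "d \<in> ?M" "e \<in> ?M" "d \<noteq> e"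
    then consider "d \<in> D" "e \<in> D" | "d \<in> D" "e \<in> X" | "d \<in> X" "e \<in> D" | "d \<in> X" "e \<in> X"
      by blast
    then show "ends G d \<inter> ends G e = {}"
      using DD XX DX[of d e] DX[of e d] \<open>d \<noteq> e\<close> by cases blast+
  qed
  then show ?thesis
    unfolding decomposable_tree_matching_def using tree D_edges X_edges
    by (intro exI[of _ ?T] exI[of _ ?M]) auto
qed

section \<open>Opposite vertices\<close>

text \<open>
  Two vertices of degree three joined by a path of length two through a vertex of degree two.
\<close>

definition opposite :: "'v \<Rightarrow> 'v \<Rightarrow> bool" where
  "opposite s t \<longleftrightarrow> s \<in> V3 \<and> t \<in> V3 \<and>
    (\<exists>e \<in> edges G. \<exists>f \<in> edges G. \<exists>x \<in> V2. e \<noteq> f \<and> ends G e = {s, x} \<and> ends G f = {t, x})"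

lemma opposite_sym: "opposite s t \<Longrightarrow> opposite t s"
  unfolding opposite_def by metis

lemma opposite_irrefl: "\<not> opposite s s"
  unfolding opposite_def
  by (metis insertI1 insertI2 link_unique soft_links subsetD V2_edge_soft)

lemma opposite_functional:
  assumes "opposite s t" "opposite s u"
  shows "t = u"
proof -
  obtain e f x where 1: "s \<in> V3" "t \<in> V3" "e \<in> edges G" "f \<in> edges G" "x \<in> V2" "e \<noteq> f"
      "ends G e = {s, x}" "ends G f = {t, x}"
    using assms(1) unfolding opposite_def by blast
  obtain e' f' y where 2: "u \<in> V3" "e' \<in> edges G" "f' \<in> edges G" "y \<in> V2" "e' \<noteq> f'"
      "ends G e' = {s, y}" "ends G f' = {u, y}"
    using assms(2) unfolding opposite_def by blast
  have "e \<in> links" "e' \<in> links" using 1 2 V2_edge_soft soft_links by blast+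
  then have "e' = e" using link_unique 1 2 by blast
  then have "y = x" using 1 2 V2_V3_disjoint by (metis doubleton_eq_iff)
  then have "f' = f" using V2_incident[of x e f f'] 1 2 \<open>e' = e\<close> by auto
  then show ?thesis using 1 2 \<open>y = x\<close> by (auto simp: doubleton_eq_iff)
qed

text \<open>
  A cycle all of whose soft edges are blocked passes each of its vertices of degree two between
  two opposite vertices.
\<close>

lemma blocked_cycle_opposite:
  assumes p: "\<And>C. C \<in> core_cycles \<Longrightarrow> p C \<in> edges C"
    and Z: "cycle_in Z G" "edges Z \<inter> soft \<subseteq> blocked p" and d: "d \<in> edges Z \<inter> soft"
  obtains s t x f C D where "C \<in> core_cycles" "D \<in> core_cycles" "s \<in> ends G (p C)"
    "t \<in> ends G (p D)" "opposite s t" "x \<in> V2" "ends G d = {s, x}" "f \<in> edges G"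
    "ends G f = {t, x}"
proof -
  have V3: "v \<in> V3" if "C \<in> core_cycles" "v \<in> ends G (p C)" for v C
    using that core_cycle_verts p core_cycle_ends by blast
  obtain x where x: "x \<in> V2" "x \<in> ends G d" using d unfolding soft_def by blast
  have "x \<in> verts Z" using cycle_in_ends(1)[OF Z(1)] d x(2) by blast
  then obtain f where f: "f \<in> edges Z" "f \<noteq> d" "x \<in> ends G f"
    using cycle_in_two_edges[OF Z(1)] by metis
  have edges: "d \<in> edges G" "f \<in> edges G" using d f cycle_in_simps(3)[OF Z(1)] by blast+
  have "f \<in> soft" using V2_edge_soft x(1) edges f by blast
  then have bl: "d \<in> blocked p" "f \<in> blocked p" using Z(2) d f by blast+
  obtain C s where C: "C \<in> core_cycles" "s \<in> ends G (p C)" "s \<in> ends G d"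
    using bl(1) unfolding blocked_def by blast
  obtain D t where D: "D \<in> core_cycles" "t \<in> ends G (p D)" "t \<in> ends G f"
    using bl(2) unfolding blocked_def by blast
  have "s \<in> V3" "t \<in> V3" using V3 C D by blast+
  then have "s \<noteq> x" "t \<noteq> x" using x(1) V2_V3_disjoint by auto
  moreover obtain w where "ends G d = {s, w}" using other_end[OF edges(1) C(3)] by metis
  moreover obtain z where "ends G f = {t, z}" using other_end[OF edges(2) D(3)] by metis
  ultimately have "ends G d = {s, x}" "ends G f = {t, x}" using x(2) f(3) by auto
  moreover from this have "opposite s t"
    using \<open>s \<in> V3\<close> \<open>t \<in> V3\<close> x(1) edges f(2) unfolding opposite_def by metis
  ultimately show ?thesis using that C D x(1) edges by blast
qed

lemma core_cycle_neighbours: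
  assumes C: "C \<in> core_cycles" "r \<in> verts C"
  obtains e f a b where "e \<in> edges C" "f \<in> edges C" "e \<noteq> f" "ends G e = {r, a}"
    "ends G f = {r, b}" "a \<in> verts C" "b \<in> verts C" "a \<noteq> r" "b \<noteq> r"
proof -
  note cyc = core_cycle_cycle_in[OF C(1)]
  obtain e f where ef: "e \<in> edges C" "f \<in> edges C" "e \<noteq> f" "r \<in> ends G e" "r \<in> ends G f"
    using cycle_in_two_edges[OF cyc C(2)] .
  obtain a where a: "a \<noteq> r" "ends G e = {r, a}"
    using other_end ef cycle_in_simps(3)[OF cyc] by (metis subsetD)
  obtain b where b: "b \<noteq> r" "ends G f = {r, b}"
    using other_end ef cycle_in_simps(3)[OF cyc] by (metis subsetD)
  have "a \<in> verts C" "b \<in> verts C" using cycle_in_ends(1)[OF cyc] ef a b by blast+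
  then show ?thesis using that ef a b by blast
qed

section \<open>Vertices far from a deleted set of soft edges\<close>

text \<open>
  For a set \<open>D\<close> of soft edges, \<open>D\<close> contains neither the link at \<open>v\<close> nor an edge that continues this
  link at a vertex of degree two.
\<close>

definition good :: "'e set \<Rightarrow> 'v \<Rightarrow> bool" where
  "good D v \<longleftrightarrow> (\<forall>e \<in> links. v \<in> ends G e \<longrightarrow>
     e \<notin> D \<and> (\<forall>x \<in> ends G e \<inter> V2. \<forall>f \<in> edges G. x \<in> ends G f \<longrightarrow> f \<notin> D))"

text \<open>
  Deletion of two parallel edges between \<open>a\<close> and \<open>b\<close> disconnects the graph, so the link at \<open>a\<close>, and
  its continuation at a vertex of degree two, are bridges. The proof compares cuts: if one of them
  were in \<open>D\<close>, then the side of \<open>a\<close>, without \<open>a\<close> and possibly the next vertex, would be a nonempty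
  set that no edge outside \<open>D\<close> leaves.
\<close>

lemma parallel_edges_good:
  assumes D: "D \<subseteq> soft" "connected_mgraph (delete_edges G D)"
    and ab: "a \<in> V3" "b \<in> V3" "a \<noteq> b"
    and e12: "e1 \<in> edges G" "e2 \<in> edges G" "e1 \<noteq> e2" "ends G e1 = {a, b}" "ends G e2 = {a, b}"
  shows "good D a"
proof (rule ccontr)
  assume "\<not> good D a"
  then obtain e where e: "e \<in> links" "a \<in> ends G e"
    and bad: "e \<in> D \<or> (\<exists>x \<in> ends G e \<inter> V2. \<exists>f \<in> edges G. x \<in> ends G f \<and> f \<in> D)"
    unfolding good_def by blast
  have eG: "e \<in> edges G" using e unfolding links_def by blast
  let ?C = "G\<lparr>verts := {a, b}, edges := {e1, e2}\<rparr>"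
  have ab_verts: "a \<in> verts G" "b \<in> verts G" using ab unfolding verts_of_degree_def by auto
  have adj: "(a, b) \<in> adj ?C" "(b, a) \<in> adj ?C"
    using e12 unfolding adj_def by auto
  have "{e. (e = e1 \<or> e = e2) \<and> v \<in> ends G e} = {e1, e2}" if "v \<in> {a, b}" for v
    using that e12 by auto
  then have "degree ?C v = 2" if "v \<in> {a, b}" for v
    using that e12(3) unfolding degree_def by auto
  moreover have "connected_mgraph ?C" using adj unfolding connected_mgraph_def by auto
  moreover have "subgraph ?C G"
    using ab ab_verts e12 unfolding subgraph_def wf_mgraph_def by auto
  ultimately have C: "cycle_in ?C G" unfolding cycle_in_def by simp
  then have core: "?C \<in> core_cycles" using ab unfolding core_cycles_def by auto
  have at_a: "g = e" if "g \<in> edges G" "a \<in> ends G g" "g \<noteq> e1" "g \<noteq> e2" for g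
    using core_cycle_edge_or_link[OF core, of a g] link_unique that e ab(1) by auto
  have e_ne: "e \<noteq> e1" "e \<noteq> e2" using e(1) core unfolding links_def by force+
  let ?H = "delete_edges G {e1, e2}"
  have "\<not> connected_mgraph ?H" "verts ?H \<noteq> {}"
    using sep[OF C] ab_verts unfolding separating_def by auto
  then obtain W where "W \<subseteq> verts ?H" "W \<noteq> {}" "W \<noteq> verts ?H"
      "\<forall>e \<in> edges ?H. \<not> crosses ?H e W"
    using not_connected_mgraph_cut[OF wf_delete_edges[OF wf]] by metis
  then have W: "W \<subseteq> verts G" "W \<noteq> {}" "W \<noteq> verts G"
    and nc: "\<And>g. g \<in> edges G \<Longrightarrow> g \<noteq> e1 \<Longrightarrow> g \<noteq> e2 \<Longrightarrow> \<not> crosses G g W"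
    by simp_all
  \<comment> \<open>The side of the cut that contains \<open>a\<close>; the other side contains \<open>b\<close>.\<close>
  obtain U where U: "U \<subseteq> verts G" "a \<in> U" "b \<notin> U"
    and nc: "\<And>g. g \<in> edges G \<Longrightarrow> g \<noteq> e1 \<Longrightarrow> g \<noteq> e2 \<Longrightarrow> \<not> crosses G g U"
  proof -
    obtain g where "g \<in> edges G" "crosses G g W"
      using connected_mgraph_crosses[OF wf conn W] .
    then have "g = e1 \<or> g = e2" using nc[of g] by blast
    then have "ends G g = {a, b}" using e12(4,5) by blast
    then consider "a \<in> W" "b \<notin> W" | "a \<notin> W" "b \<in> W"
      using \<open>crosses G g W\<close> unfolding crosses_def by auto
    then show ?thesis
    proof cases
      case 1
      then show ?thesis using that W nc by blast
    next
      case 2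
      have "\<not> crosses G g (verts G - W)" if "g \<in> edges G" "g \<noteq> e1" "g \<noteq> e2" for g
        using nc[OF that] ends_verts[OF that(1)] unfolding crosses_def by blast
      then show ?thesis using that[of "verts G - W"] 2 ab_verts by blast
    qed
  qed
  have no_cut: "Y = {}" if Y: "Y \<subseteq> U - {a}" "\<And>g. g \<in> edges G - D \<Longrightarrow> \<not> crosses G g Y" for Y
  proof -
    have "Y \<subseteq> verts G" "Y \<noteq> verts G" using Y(1) U ab_verts by auto
    then show ?thesis
      using connected_mgraph_crosses[OF wf_delete_edges[OF wf] D(2), of Y] Y(2)
      by (metis crosses_delete_edges delete_edges_simps(1,2))
  qed
  have meets: "ends G g \<subseteq> U \<and> g \<noteq> e1 \<and> g \<noteq> e2"
    if "g \<in> edges G" "crosses G g Y" "Y \<subseteq> U - {a}" for g Y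
  proof -
    have "g \<noteq> e1" "g \<noteq> e2" using that U e12 unfolding crosses_def by auto
    then show ?thesis using nc[OF that(1)] that unfolding crosses_def by blast
  qed
  obtain y where y: "y \<noteq> a" "ends G e = {a, y}" using other_end[OF eG e(2)] by metis
  have yU: "y \<in> U" using nc[OF eG e_ne] y U(2) unfolding crosses_def by auto
  show False
  proof (cases "e \<in> D")
    case True
    have "\<not> crosses G g (U - {a})" if g: "g \<in> edges G - D" for g
    proof
      assume cr: "crosses G g (U - {a})"
      then have "ends G g \<subseteq> U" "g \<noteq> e1" "g \<noteq> e2" using meets g by blast+
      then have "g = e" using at_a cr g unfolding crosses_def by blast
      then show False using True g by blast
    qed
    then have "U - {a} = {}" using no_cut by blast
    then show False using yU y(1) by blast
  next
    case False
    then obtain f where x: "y \<in> V2" and f: "f \<in> edges G" "y \<in> ends G f" "f \<in> D"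
      using bad y ab(1) V2_V3_disjoint by auto
    have "f \<noteq> e" using False f by auto
    have "\<not> crosses G g (U - {a, y})" if g: "g \<in> edges G - D" for g
    proof
      assume cr: "crosses G g (U - {a, y})"
      then have g': "ends G g \<subseteq> U" "g \<noteq> e1" "g \<noteq> e2" using meets[of g "U - {a, y}"] g by blast+
      then have "a \<in> ends G g \<or> y \<in> ends G g" using cr unfolding crosses_def by blast
      then have "g = e" using at_a g g' V2_incident[OF x, of e f g] eG f y \<open>f \<noteq> e\<close> by blast
      then show False using cr y unfolding crosses_def by auto
    qed
    then have U': "U - {a, y} = {}" using no_cut[of "U - {a, y}"] by blast
    obtain z where z: "z \<noteq> y" "ends G f = {y, z}" using other_end[OF f(1,2)] by metis
    have "z \<noteq> a"
      using link_unique[OF ab(1) e] f D(1) soft_links z \<open>f \<noteq> e\<close> by blast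
    have "f \<in> links" using f D(1) soft_links by blast
    then have "f \<noteq> e1" "f \<noteq> e2" using core unfolding links_def by force+
    then have "z \<in> U" using nc[OF f(1)] z yU unfolding crosses_def by auto
    then show False using U' z \<open>z \<noteq> a\<close> by blast
  qed
qed

text \<open>
  If a core cycle has no good vertex, then every link at it is in \<open>D\<close>, or leads to a vertex of degree
  two at which the other edge is in \<open>D\<close>. As the graph without \<open>D\<close> is connected, it then has no
  vertices but those of the cycle and these neighbours of degree two, hence no other core cycle.
\<close>

lemma no_good_vertex_single_core_cycle:
  assumes D: "D \<subseteq> soft" "connected_mgraph (delete_edges G D)"
    and C: "C \<in> core_cycles" "\<And>v. v \<in> verts C \<Longrightarrow> \<not> good D v"
  shows "core_cycles = {C}"
proof -
  define W where "W = verts C \<union> {x \<in> V2. \<exists>v \<in> verts C. \<exists>e \<in> edges G - D. ends G e = {v, x}}"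
  note cyc = core_cycle_cycle_in[OF C(1)]
  have bad: "e \<in> D \<or> (\<exists>x \<in> ends G e \<inter> V2. \<exists>f \<in> edges G. x \<in> ends G f \<and> f \<in> D)"
    if "v \<in> verts C" "e \<in> links" "v \<in> ends G e" for v e
    using C(2)[OF that(1)] link_unique[OF core_cycle_verts[OF C(1) that(1)]] that(2,3)
    unfolding good_def by metis
  have no_cut: "\<not> crosses G e W" if e: "e \<in> edges G - D" for e
  proof
    assume cr: "crosses G e W"
    then obtain y where y: "y \<in> ends G e" "y \<in> W" unfolding crosses_def by blast
    obtain z where z: "z \<noteq> y" "ends G e = {y, z}" "z \<in> verts G"
      using other_end y(1) e by (metis DiffD1)
    have zW: "z \<notin> W" using cr y z unfolding crosses_def by auto
    show False
    proof (cases "y \<in> verts C")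
      case True
      have "e \<notin> edges C" using cycle_in_ends(1)[OF cyc] z zW unfolding W_def by blast
      then have "e \<in> links" using core_cycle_edge_or_link[OF C(1) True] e y(1) by blast
      then obtain x where "x \<in> ends G e" "x \<in> V2" using bad[OF True] y(1) e by blast
      then have "z \<in> V2" using z core_cycle_verts[OF C(1) True] V2_V3_disjoint by auto
      then show False using zW e z(2) True unfolding W_def by blast
    next
      case False
      then obtain v g where v: "y \<in> V2" "v \<in> verts C" "g \<in> edges G - D" "ends G g = {v, y}"
        using y(2) unfolding W_def by blast
      have "g \<in> links" using v V2_edge_soft soft_links by blast
      then obtain x f where x: "x \<in> ends G g" "x \<in> V2" "f \<in> edges G" "x \<in> ends G f" "f \<in> D"
        using bad[OF v(2)] v(3,4) by blast
      then have "x = y" using v core_cycle_verts[OF C(1) v(2)] V2_V3_disjoint by auto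
      moreover have "g \<noteq> e" using v(2,4) z zW unfolding W_def by auto
      ultimately have "f = g \<or> f = e"
        using V2_incident[OF v(1), of g e f] v e y(1) x by auto
      then show False using x(5) v(3) e by blast
    qed
  qed
  have "W \<subseteq> verts G" "W \<noteq> {}"
    using cycle_in_simps(2,7)[OF cyc] unfolding W_def verts_of_degree_def by auto
  then have W: "W = verts G"
    using connected_mgraph_crosses[OF wf_delete_edges[OF wf] D(2), of W] no_cut
    by (metis crosses_delete_edges delete_edges_simps(1,2))
  have V3: "v \<in> verts C" if v: "v \<in> V3" for v
  proof -
    have "v \<in> verts G" using v unfolding verts_of_degree_def by simp
    then have "v \<in> W" using W by simp
    then show ?thesis using v V2_V3_disjoint unfolding W_def by blast
  qed
  have "B = C" if B: "B \<in> core_cycles" for B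
  proof -
    obtain v where "v \<in> verts B" using core_cycle_nonempty[OF B] by blast
    then show ?thesis using core_cycle_unique[OF B _ C(1)] core_cycle_verts[OF B] V3 by blast
  qed
  then show ?thesis using C(1) by blast
qed

section \<open>The decomposition\<close>

lemma decomposable: "decomposable_tree_matching G"
proof -
  obtain D where D: "D \<subseteq> soft" "connected_mgraph (delete_edges G D)"
    and max: "\<And>Z. cycle_in Z G \<Longrightarrow> edges Z \<inter> D = {} \<Longrightarrow> edges Z \<inter> soft = {}"
    using maximal_soft_deletion[of "{}"] by (metis Diff_empty subset_empty)
  show ?thesis
  proof (cases "\<exists>C \<in> core_cycles. \<forall>v \<in> verts C. \<not> good D v")
    case True
    then obtain C where C: "C \<in> core_cycles" "\<And>v. v \<in> verts C \<Longrightarrow> \<not> good D v" by blast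
    \<comment> \<open>A vertex \<open>u\<close> has two neighbours on \<open>C\<close>, and at most one of them is opposite to it.\<close>
    have single: "core_cycles = {C}" using no_good_vertex_single_core_cycle[OF D C] .
    note cyc = core_cycle_cycle_in[OF C(1)]
    obtain u where u: "u \<in> verts C" using core_cycle_nonempty[OF C(1)] by blast
    obtain e f a b where ef: "e \<in> edges C" "f \<in> edges C" "e \<noteq> f" "ends G e = {u, a}"
        "ends G f = {u, b}" "a \<in> verts C" "b \<in> verts C" "a \<noteq> u" "b \<noteq> u"
      using core_cycle_neighbours[OF C(1) u] .
    have "a \<noteq> b"
      using parallel_edges_good[OF D, of u a e f] core_cycle_verts[OF C(1)] C(2)[OF u] u ef
        cycle_in_simps(3)[OF cyc] by blast
    then have "\<not> opposite u a \<or> \<not> opposite u b" using opposite_functional by blast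
    then obtain g w where g: "g \<in> edges C" "ends G g = {u, w}" "\<not> opposite u w"
      using ef by blast
    have p: "\<And>B. B \<in> core_cycles \<Longrightarrow> g \<in> edges B" using g(1) single by auto
    have "edges Z \<inter> soft = {}" if Z: "cycle_in Z G" "edges Z \<inter> soft \<subseteq> blocked (\<lambda>_. g)" for Z
    proof (rule ccontr)
      assume "edges Z \<inter> soft \<noteq> {}"
      then obtain d where d: "d \<in> edges Z \<inter> soft" by blast
      obtain s t where "s \<in> ends G g" "t \<in> ends G g" "opposite s t"
        using blocked_cycle_opposite[of "\<lambda>_. g", OF p Z d] by metis
      then show False using g(2,3) opposite_sym opposite_irrefl by auto
    qed
    then show ?thesis using decomposition_of_selection[of "\<lambda>_. g"] p by blast
  next
    case False
    then have "\<forall>C. \<exists>v. C \<in> core_cycles \<longrightarrow> v \<in> verts C \<and> good D v" by blast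
    then obtain r where r: "\<And>C. C \<in> core_cycles \<Longrightarrow> r C \<in> verts C \<and> good D (r C)" by metis
    \<comment> \<open>Only cycles without an edge between two good vertices need a choice of neighbour.\<close>
    define X where "X = {C \<in> core_cycles. \<not> (\<exists>e \<in> edges C. \<forall>v \<in> ends G e. good D v)}"
    let ?S = "\<lambda>C. {w. \<exists>e \<in> edges C. ends G e = {r C, w}}"
    \<comment> \<open>No vertex has to be avoided here; \<open>undefined\<close> only fills that place of the lemma.\<close>
    have "\<exists>s. \<forall>C \<in> X. s C \<in> ?S C \<and> s C \<noteq> undefined \<and> (\<forall>B \<in> X. \<not> opposite (s C) (s B))"
    proof (rule conflict_free_selection)
      show "finite X" using finite_core_cycles unfolding X_def by simp
    next
      fix C assume C: "C \<in> X"
      then have rC: "r C \<in> verts C" "good D (r C)" "C \<in> core_cycles" using r unfolding X_def by auto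
      obtain e f a b where ef: "e \<in> edges C" "f \<in> edges C" "e \<noteq> f" "ends G e = {r C, a}"
          "ends G f = {r C, b}" "a \<in> verts C" "b \<in> verts C" "a \<noteq> r C" "b \<noteq> r C"
        using core_cycle_neighbours[OF rC(3,1)] .
      have "\<not> good D a" using C ef rC(2) unfolding X_def by auto
      then have "a \<noteq> b"
        using parallel_edges_good[OF D, of a "r C" e f] core_cycle_verts[OF rC(3)] rC(1) ef
          cycle_in_simps(3)[OF core_cycle_cycle_in[OF rC(3)]] by (auto simp: insert_commute)
      then show "\<exists>a \<in> ?S C. \<exists>b \<in> ?S C. a \<noteq> b" using ef by blast
    next
      fix B C a assume BC: "B \<in> X" "C \<in> X" "a \<in> ?S B" "a \<in> ?S C"
      then have "a \<in> verts B" "a \<in> verts C"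
        using core_cycle_ends[of B _ a] core_cycle_ends[of C _ a] unfolding X_def by auto
      then show "B = C" using core_cycle_unique BC(1,2) unfolding X_def by blast
    qed (use opposite_sym opposite_irrefl opposite_functional in blast)+
    then obtain s where s: "\<And>C. C \<in> X \<Longrightarrow> \<exists>e \<in> edges C. ends G e = {r C, s C}"
      and nopp: "\<And>B C. B \<in> X \<Longrightarrow> C \<in> X \<Longrightarrow> \<not> opposite (s B) (s C)" by blast
    have "\<forall>C \<in> core_cycles. \<exists>e. e \<in> edges C \<and> (\<forall>v \<in> ends G e. good D v \<or> C \<in> X \<and> v = s C)"
    proof
      fix C assume C: "C \<in> core_cycles"
      show "\<exists>e. e \<in> edges C \<and> (\<forall>v \<in> ends G e. good D v \<or> C \<in> X \<and> v = s C)"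
      proof (cases "C \<in> X")
        case True
        then show ?thesis using s[OF True] r[OF C] by fastforce
      next
        case False
        then show ?thesis using C unfolding X_def by blast
      qed
    qed
    from bchoice[OF this] obtain p where "\<forall>C \<in> core_cycles. p C \<in> edges C \<and>
        (\<forall>v \<in> ends G (p C). good D v \<or> C \<in> X \<and> v = s C)" ..
    then have p: "\<And>C. C \<in> core_cycles \<Longrightarrow> p C \<in> edges C"
      and ps: "\<And>C v. C \<in> core_cycles \<Longrightarrow> v \<in> ends G (p C) \<Longrightarrow> \<not> good D v \<Longrightarrow> C \<in> X \<and> v = s C"
      by simp_all metis
    have "edges Z \<inter> soft = {}" if Z: "cycle_in Z G" "edges Z \<inter> soft \<subseteq> blocked p" for Z
    proof (rule ccontr)
      assume "edges Z \<inter> soft \<noteq> {}"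
      then obtain d where d: "d \<in> edges Z" "d \<in> D" using max[OF Z(1)] by blast
      then have "d \<in> edges Z \<inter> soft" using D(1) by blast
      then obtain u t x f B C where w: "B \<in> core_cycles" "C \<in> core_cycles" "u \<in> ends G (p B)"
          "t \<in> ends G (p C)" "opposite u t" "x \<in> V2" "ends G d = {u, x}" "f \<in> edges G"
          "ends G f = {t, x}"
        using blocked_cycle_opposite[OF p Z] by metis
      have dG: "d \<in> edges G" using d cycle_in_simps(3)[OF Z(1)] by blast
      have links: "d \<in> links" "f \<in> links" using w dG V2_edge_soft soft_links by blast+
      have "\<not> good D u" using links(1) w(7) d(2) unfolding good_def by blast
      moreover have "\<not> good D t" using links(2) w(6,7,9) d(2) dG unfolding good_def by blast
      \<comment> \<open>So \<open>u\<close> and \<open>t\<close> are chosen neighbours, which are never opposite.\<close>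
      ultimately show False using ps w(1-5) nopp by metis
    qed
    then show ?thesis using decomposition_of_selection[of p] p by blast
  qed
qed

end

theorem theorem1p3:
  fixes G :: "('v, 'e) mgraph"
  assumes "G \<in> S23"
    and "\<forall>K. component K (delete_verts G (verts_of_degree 2 G)) \<longrightarrow> thick_cactus K"
  shows "decomposable_tree_matching G"
proof -
  interpret thick_cacti_graph G using assms by unfold_locales auto
  show ?thesis by (rule decomposable)
qed

end
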